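(* Let $A\in\mathbb{R}^{n\times n}$ be symmetric, let $m\ge1$ be an integer, and let $f(P)=\mathrm{tr}((P^{\mathrm T}AP)^m)$ with associated symmetric matrix-valued function $$H(P)=2m\,A(PP^{\mathrm T}A)^{m-1},$$ so that $\frac{\partial f(P)}{\partial P}=H(P)P$ for $P\in\mathbb{R}^{n\times k}$. (a) For $P\in\mathbb{R}^{n\times k}$, $\mathrm{tr}(P^{\mathrm T}H(P)P)=2m\,f(P)=2m\,\mathrm{tr}((P^{\mathrm T}AP)^m)$. (b) Let $P,\widetilde P\in\mathbb{R}^{n\times k}$. (i) For $m=1$, we always have $\mathrm{tr}(\widetilde P^{\mathrm T}H(P)\widetilde P)=2\,\mathrm{tr}(\widetilde P^{\mathrm T}A\widetilde P)$. (ii) For $m>1$, if $A\succeq0$, then $$\mathrm{tr}(\widetilde P^{\mathrm T}H(P)\widetilde P)\le2\,\mathrm{tr}((\widetilde P^{\mathrm T}A\widetilde P)^m)+2(m-1)\,\mathrm{tr}((P^{\mathrm T}AP)^m).$$ These imply (for $m=1$, or for $m>1$ with $A\succeq0$) that conditions (1) and (2) of the definition of an atomic function for NEPv hold with $\underline{\alpha}=2$, $\underline{\beta}=2(m-1)$ and $\mathbb{P}=\mathrm{St}(k,n)$, and thus $f(P)=\mathrm{tr}((P^{\mathrm T}AP)^m)$ is an atomic function for NEPv.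
   Context: $1\le k\le n$; $\mathrm{St}(k,n)=\{P\in\mathbb{R}^{n\times k}: P^{\mathrm T}P=I_k\}$; $A\succeq0$ means symmetric positive semidefinite; $\partial f(P)/\partial P$ is the $n\times k$ matrix of partial derivatives with all entries of $P$ treated as independent. Atomic function for NEPv: a function $f$ on a neighborhood $\{P\in\mathbb{R}^{n\times k}:\|P^{\mathrm T}P-I_k\|<\delta\}$ of $\mathrm{St}(k,n)$ for which there are a symmetric matrix-valued function $H(P)\in\mathbb{R}^{n\times n}$ for $P\in\mathrm{St}(k,n)$, a subset $\mathbb{P}\subseteq\mathrm{St}(k,n)$ and constants $\underline{\alpha}>0$, $\underline{\beta}\ge 0$, $\underline{\gamma}=\underline{\alpha}+\underline{\beta}$ such that (1) $\mathrm{tr}(P^{\mathrm T}H(P)P)=\underline{\gamma} f(P)$ for all $P\in\mathbb{P}$; and (2) given $P\in\mathbb{P}$ and $\widehat P\in\mathrm{St}(k,n)$, there exists $Q\in\mathrm{St}(k,k)$ such that $\widetilde P=\widehat PQ\in\mathbb{P}$ and $\mathrm{tr}(\widehat P^{\mathrm T}H(P)\widehat P)\le\underline{\alpha} f(\widetilde P)+\underline{\beta} f(P)$. *)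

theory Defs
  imports "HOL-Analysis.Analysis"
begin

text \<open>An $n \times k$ real matrix is an element of \<open>real^'k^'n\<close>, with \<open>n = CARD('n)\<close> and
  \<open>k = CARD('k)\<close>.\<close>

text \<open>Powers for the matrix product \<open>**\<close>; the operations \<open>*\<close> and \<open>^\<close> on vector types would be
  componentwise.\<close>

primrec matpow :: "real^'n^'n \<Rightarrow> nat \<Rightarrow> real^'n^'n" where
  "matpow M 0 = mat 1"
| "matpow M (Suc m) = M ** matpow M m"

definition symmetric_matrix :: "real^'n^'n \<Rightarrow> bool" where
  "symmetric_matrix M \<longleftrightarrow> transpose M = M"

definition psd_matrix :: "real^'n^'n \<Rightarrow> bool" where
  "psd_matrix M \<longleftrightarrow> symmetric_matrix M \<and> (\<forall>x. 0 \<le> x \<bullet> (M *v x))"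

definition stiefel :: "(real^'k^'n) set" where
  "stiefel = {P. transpose P ** P = mat 1}"

text \<open>The norm of \<open>real^'k^'k\<close> is the Frobenius norm.\<close>

definition stiefel_nbhd :: "real \<Rightarrow> (real^'k^'n) set" where
  "stiefel_nbhd \<delta> = {P. norm (transpose P ** P - mat 1) < \<delta>}"

text \<open>\<open>has_partials f G P\<close>: all partial derivatives of \<open>f\<close> at \<open>P\<close> with respect to the entries of
  the matrix argument, taken as independent variables, exist, and they form the matrix \<open>G\<close>.
  The matrix \<open>axis i (axis j 1)\<close> has the entry 1 at position \<open>(i, j)\<close> and 0 elsewhere.\<close>

definition has_partials :: "(real^'k^'n \<Rightarrow> real) \<Rightarrow> real^'k^'n \<Rightarrow> real^'k^'n \<Rightarrow> bool" where
  "has_partials f G P \<longleftrightarrow>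
     (\<forall>i j. ((\<lambda>t. f (P + t *\<^sub>R axis i (axis j 1))) has_real_derivative G $ i $ j) (at 0))"

definition atomic_cond1 ::
  "(real^'k^'n \<Rightarrow> real) \<Rightarrow> (real^'k^'n \<Rightarrow> real^'n^'n) \<Rightarrow> (real^'k^'n) set \<Rightarrow> real \<Rightarrow> real \<Rightarrow> bool" where
  "atomic_cond1 f H PP \<alpha> \<beta> \<longleftrightarrow>
     (\<forall>P\<in>PP. trace (transpose P ** H P ** P) = (\<alpha> + \<beta>) * f P)"

definition atomic_cond2 ::
  "(real^'k^'n \<Rightarrow> real) \<Rightarrow> (real^'k^'n \<Rightarrow> real^'n^'n) \<Rightarrow> (real^'k^'n) set \<Rightarrow> real \<Rightarrow> real \<Rightarrow> bool" where
  "atomic_cond2 f H PP \<alpha> \<beta> \<longleftrightarrow>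
     (\<forall>P\<in>PP. \<forall>P'\<in>stiefel. \<exists>Q::real^'k^'k. Q \<in> stiefel \<and> P' ** Q \<in> PP \<and>
        trace (transpose P' ** H P ** P') \<le> \<alpha> * f (P' ** Q) + \<beta> * f P)"

text \<open>A function on a neighbourhood \<open>D\<close> of the Stiefel manifold is modelled by a total function whose
  values outside \<open>D\<close> are irrelevant.\<close>

definition atomic_function_NEPv :: "(real^'k^'n) set \<Rightarrow> (real^'k^'n \<Rightarrow> real) \<Rightarrow> bool" where
  "atomic_function_NEPv D f \<longleftrightarrow>
     (\<exists>\<delta>>0. D = stiefel_nbhd \<delta>) \<and>
     (\<exists>H PP \<alpha> \<beta>. (\<forall>P\<in>stiefel. symmetric_matrix (H P)) \<and> PP \<subseteq> stiefel \<and> \<alpha> > 0 \<and> \<beta> \<ge> 0 \<and>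
        atomic_cond1 f H PP \<alpha> \<beta> \<and> atomic_cond2 f H PP \<alpha> \<beta>)"

end

theory Submission
  imports Defs
begin

text \<open>Writing \<open>A = B ** B\<close> with \<open>B\<close> symmetric, the matrices \<open>X = (B P') (B P')\<^sup>T\<close> and
  \<open>Y = (B P) (B P)\<^sup>T\<close> are positive semidefinite, and cyclicity of the trace turns the inequality for
  \<open>f\<close> into \<open>m tr (X Y\<^bsup>m-1\<^esup>) \<le> tr (X\<^bsup>m\<^esup>) + (m - 1) tr (Y\<^bsup>m\<^esup>)\<close>. The latter follows from
  the scalar Young inequality by diagonalizing \<open>X\<close> and \<open>Y\<close>.\<close>

section \<open>The spectral theorem for real symmetric matrices\<close>

text \<open>A maximizer of the Rayleigh quotient on the unit sphere of \<open>S\<close> is an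
  eigenvector, because its first variation vanishes in every direction of \<open>S\<close>
  orthogonal to it. The invariant subspace \<open>S\<close> makes the lemma reusable on orthogonal
  complements.\<close>

lemma self_adjoint_eigenvector:
  fixes f :: "'a::euclidean_space \<Rightarrow> 'a"
  assumes lin: "linear f" and adj: "\<And>x y. f x \<bullet> y = x \<bullet> f y"
    and S: "subspace S" and inv: "\<And>x. x \<in> S \<Longrightarrow> f x \<in> S"
    and ne: "\<exists>x\<in>S. x \<noteq> 0"
  obtains x c where "x \<in> S" "norm x = 1" "f x = c *\<^sub>R x"
proof -
  let ?K = "S \<inter> sphere 0 1"
  obtain z where z: "z \<in> S" "z \<noteq> 0" using ne by blast
  have "z /\<^sub>R norm z \<in> ?K"
    using z S by (auto simp: subspace_scale)
  then have "?K \<noteq> {}" by blast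
  moreover have "compact ?K"
    by (intro closed_Int_compact closed_subspace S compact_sphere)
  moreover have "continuous_on ?K (\<lambda>x. x \<bullet> f x)"
    by (intro continuous_intros linear_continuous_on_compose[OF _ lin])
  ultimately obtain x where x: "x \<in> ?K" and max: "\<And>y. y \<in> ?K \<Longrightarrow> y \<bullet> f y \<le> x \<bullet> f x"
    using continuous_attains_sup[of ?K "\<lambda>x. x \<bullet> f x"] by metis
  define c where "c = x \<bullet> f x"
  have nx: "x \<bullet> x = 1" and xS: "x \<in> S" using x by (auto simp: norm_eq_1)
  have le: "y \<bullet> f y \<le> c * (y \<bullet> y)" if "y \<in> S" for y
  proof (cases "y = 0")
    case False
    have "y /\<^sub>R norm y \<in> ?K" using that False S by (auto simp: subspace_scale)
    from max[OF this] have "(y \<bullet> f y) / (norm y)\<^sup>2 \<le> c"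
      by (simp add: linear_scale[OF lin] c_def power2_eq_square divide_inverse mult_ac)
    then show ?thesis
      using False by (simp add: divide_le_eq dot_square_norm)
  qed (simp add: linear_0[OF lin])
  have orth: "y \<bullet> f x = 0" if y: "y \<in> S" "x \<bullet> y = 0" for y
  proof -
    define a where "a = y \<bullet> f x"
    define b where "b = c * (y \<bullet> y) - y \<bullet> f y"
    \<comment> \<open>Compare the quadratic form at the maximizer with its value at
      \<open>x + t *\<^sub>R y\<close>. A linear term in \<open>t\<close> is bounded by a quadratic
      one, which forces its coefficient \<open>a\<close> to vanish.\<close>
    have *: "2 * t * a \<le> t * t * b" for t
    proof -
      have "x + t *\<^sub>R y \<in> S" using xS y S by (simp add: subspace_add subspace_scale)
      from le[OF this] have "c + 2 * t * a + t * t * (y \<bullet> f y) \<le> c * (1 + t * t * (y \<bullet> y))"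
        using y adj[of x y]
        by (simp add: linear_add[OF lin] linear_scale[OF lin] inner_add_left inner_add_right
            nx a_def c_def[symmetric] inner_commute algebra_simps)
      then show ?thesis by (simp add: b_def algebra_simps)
    qed
    have b0: "b \<ge> 0" using *[of 1] *[of "-1"] by simp
    \<comment> \<open>The shift by 1 keeps the denominator positive when \<open>b = 0\<close>. With
      this \<open>t\<close> the bound reads
      \<open>2 * t * t * (b + 1) \<le> t * t * b\<close>.\<close>
    define t where "t = a / (b + 1)"
    have a: "a = t * (b + 1)" using b0 by (simp add: t_def)
    have "t * t * (b + 2) \<le> 0" using *[of t] unfolding a by (simp add: algebra_simps)
    then have "t * t \<le> 0" using b0 by (simp add: mult_le_0_iff)
    then have "t = 0" by (auto simp: mult_le_0_iff)
    then have "a = 0" using a by simp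
    then show ?thesis by (simp add: a_def)
  qed
  \<comment> \<open>This is the part of \<open>f x\<close> orthogonal to \<open>x\<close>. It is
    orthogonal to both \<open>f x\<close> and \<open>x\<close>, hence to itself.\<close>
  define y where "y = f x - c *\<^sub>R x"
  have "y \<in> S" unfolding y_def using xS S inv by (simp add: subspace_diff subspace_scale)
  moreover have xy: "x \<bullet> y = 0" by (simp add: y_def inner_diff_right nx c_def)
  ultimately have "y \<bullet> f x = 0" by (rule orth)
  then have "y \<bullet> y = 0" using xy by (simp add: y_def inner_diff_right inner_commute)
  then have "f x = c *\<^sub>R x" by (simp add: y_def)
  with that xS nx show thesis by (simp add: norm_eq_1)
qed

text \<open>Induction on the number of vectors: self-adjointness makes the orthogonal complement
  \<open>S\<close> of the eigenvectors found so far invariant, so a further eigenvector exists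
  there. The count \<open>k\<close> equal to the dimension gives an eigenbasis.\<close>

lemma self_adjoint_orthonormal_eigenvectors:
  fixes f :: "'a::euclidean_space \<Rightarrow> 'a"
  assumes lin: "linear f" and adj: "\<And>x y. f x \<bullet> y = x \<bullet> f y"
    and "k \<le> DIM('a)"
  shows "\<exists>B. card B = k \<and> finite B \<and> pairwise orthogonal B \<and>
           (\<forall>b\<in>B. norm b = 1 \<and> (\<exists>c. f b = c *\<^sub>R b))"
  using \<open>k \<le> DIM('a)\<close>
proof (induction k)
  case 0
  then show ?case by (intro exI[of _ "{}"]) auto
next
  case (Suc k)
  then obtain B where B: "card B = k" "finite B" "pairwise orthogonal B"
    "\<And>b. b \<in> B \<Longrightarrow> norm b = 1" "\<And>b. b \<in> B \<Longrightarrow> \<exists>c. f b = c *\<^sub>R b"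
    by auto
  define S where "S = {y. \<forall>b\<in>B. b \<bullet> y = 0}"
  have "dim B < DIM('a)"
    using dim_le_card[OF order.refl B(2)] B(1) Suc.prems dim_le_card'[OF B(2)] by linarith
  then obtain z where "z \<noteq> 0" "\<And>y. y \<in> span B \<Longrightarrow> orthogonal z y"
    using orthogonal_to_subspace_exists[of B] by metis
  then have "z \<in> S" "z \<noteq> 0"
    by (auto simp: S_def orthogonal_def inner_commute span_base)
  then have "\<exists>z\<in>S. z \<noteq> 0" by blast
  moreover have "subspace S"
    by (auto simp: S_def subspace_def inner_add_right)
  moreover have "f y \<in> S" if "y \<in> S" for y
  proof -
    have "b \<bullet> f y = 0" if b: "b \<in> B" for b
    proof -
      obtain c where "f b = c *\<^sub>R b" using B(5) b by blast
      then show ?thesis using adj[of b y] \<open>y \<in> S\<close> b by (simp add: S_def)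
    qed
    then show ?thesis by (simp add: S_def)
  qed
  ultimately obtain x c where x: "x \<in> S" "norm x = 1" "f x = c *\<^sub>R x"
    using self_adjoint_eigenvector[OF lin adj] by metis
  have xB: "x \<notin> B"
    using x by (auto simp: S_def norm_eq_1)
  have "pairwise orthogonal (insert x B)"
    using B(3) x(1) by (auto simp: pairwise_insert orthogonal_def S_def inner_commute)
  then show ?case
    using B x xB by (intro exI[of _ "insert x B"]) auto
qed

section \<open>Diagonal matrices and orthogonal diagonalization\<close>

definition diagonal :: "('n \<Rightarrow> real) \<Rightarrow> real^'n^'n" where
  "diagonal d = (\<chi> i j. if i = j then d i else 0)"

lemma transpose_diagonal [simp]: "transpose (diagonal d) = diagonal d"
  by (auto simp: diagonal_def transpose_def vec_eq_iff)

lemma matrix_mult_diagonal_nth: "(M ** diagonal d) $ i $ j = M $ i $ j * d j"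
  by (simp add: matrix_matrix_mult_def diagonal_def if_distrib cong: if_cong)

lemma diagonal_mult_matrix_nth: "(diagonal d ** M) $ i $ j = d i * M $ i $ j"
  by (simp add: matrix_matrix_mult_def diagonal_def if_distrib if_distribR cong: if_cong)

lemma diagonal_mult_diagonal: "diagonal d ** diagonal e = diagonal (\<lambda>i. d i * e i)"
  by (auto simp: vec_eq_iff matrix_mult_diagonal_nth) (auto simp: diagonal_def)

lemma matpow_diagonal: "matpow (diagonal d) m = diagonal (\<lambda>i. d i ^ m)"
  by (induction m) (auto simp: diagonal_mult_diagonal, auto simp: diagonal_def mat_def vec_eq_iff)

theorem symmetric_matrix_diagonalization:
  fixes M :: "real^'n^'n"
  assumes "symmetric_matrix M"
  obtains U d where "orthogonal_matrix U" "M = U ** diagonal d ** transpose U"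
proof -
  have adj: "(M *v x) \<bullet> y = x \<bullet> (M *v y)" for x y
    using assms by (metis dot_lmul_matrix symmetric_matrix_def transpose_matrix_vector)
  obtain B :: "(real^'n) set" where B: "card B = CARD('n)" "finite B" "pairwise orthogonal B"
    "\<And>b. b \<in> B \<Longrightarrow> norm b = 1" "\<And>b. b \<in> B \<Longrightarrow> \<exists>c. M *v b = c *\<^sub>R b"
    using self_adjoint_orthonormal_eigenvectors[of "(*v) M" "CARD('n)", OF _ adj] by auto
  \<comment> \<open>The columns of \<open>U\<close> are indexed by \<open>'n\<close>, so the
    eigenbasis, which has \<open>CARD('n)\<close> elements, is enumerated by that type.\<close>
  obtain h :: "'n \<Rightarrow> real^'n" where h: "bij_betw h UNIV B"
    using finite_same_card_bij[of "UNIV :: 'n set" B] B by auto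
  have hB: "h i \<in> B" for i using h by (auto simp: bij_betw_def)
  obtain d where d: "\<And>i. M *v h i = d i *\<^sub>R h i"
    using B(5)[OF hB] by metis
  define U :: "real^'n^'n" where "U = (\<chi> i j. h j $ i)"
  have col: "column j U = h j" for j
    by (simp add: column_def U_def vec_eq_iff)
  have U: "orthogonal_matrix U"
    unfolding orthogonal_matrix_orthonormal_columns col
    using B(4) hB pairwiseD[OF B(3) hB hB] h by (metis UNIV_I bij_betw_inv_into_left)
  have "M ** U = U ** diagonal d"
  proof -
    have "(M ** U) $ i $ j = (M *v h j) $ i" for i j
      by (simp add: U_def matrix_matrix_mult_def matrix_vector_mult_def)
    then show ?thesis
      by (auto simp: vec_eq_iff matrix_mult_diagonal_nth d) (simp add: U_def)
  qed
  then have "M ** (U ** transpose U) = U ** diagonal d ** transpose U"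
    by (metis matrix_mul_assoc)
  with that U show thesis by (auto simp: orthogonal_matrix_def)
qed

text \<open>Each eigenvalue is the value of the quadratic form of \<open>M\<close> at the
  corresponding column of \<open>U\<close>, hence nonnegative.\<close>

lemma psd_matrix_diagonalization:
  fixes M :: "real^'n^'n"
  assumes "psd_matrix M"
  obtains U d where "orthogonal_matrix U" "M = U ** diagonal d ** transpose U" "\<And>i. d i \<ge> 0"
proof -
  obtain U d where U: "orthogonal_matrix U" "M = U ** diagonal d ** transpose U"
    using assms symmetric_matrix_diagonalization unfolding psd_matrix_def by metis
  have "d i \<ge> 0" for i
  proof -
    have "transpose U ** M ** U = diagonal d"
      using U by (metis matrix_mul_assoc matrix_mul_lid matrix_mul_rid orthogonal_matrix)
    then have "d i = (transpose U ** M ** U) $ i $ i" by (simp add: diagonal_def)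
    also have "\<dots> = column i U \<bullet> (M *v column i U)"
      by (simp add: matrix_mul_assoc[symmetric])
        (simp add: matrix_matrix_mult_def matrix_vector_mult_def transpose_def column_def inner_vec_def)
    finally show ?thesis using assms by (simp add: psd_matrix_def)
  qed
  with U that show thesis by blast
qed

lemma psd_matrix_sqrt:
  fixes A :: "real^'n^'n"
  assumes "psd_matrix A"
  obtains B :: "real^'n^'n" where "transpose B = B" "A = B ** B"
proof -
  obtain U d where U: "orthogonal_matrix U" and A: "A = U ** diagonal d ** transpose U"
    and d: "\<And>i. d i \<ge> 0"
    using psd_matrix_diagonalization[OF assms] by metis
  define D where "D = diagonal (\<lambda>i. sqrt (d i))"
  have D: "D ** D = diagonal d" "transpose D = D"
    using d by (simp_all add: D_def diagonal_mult_diagonal)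
  let ?B = "U ** D ** transpose U"
  have "transpose ?B = ?B"
    by (simp add: matrix_transpose_mul D matrix_mul_assoc)
  moreover have "A = ?B ** ?B"
    unfolding A D(1)[symmetric] using U
    by (metis matrix_mul_assoc matrix_mul_rid orthogonal_matrix)
  ultimately show thesis using that by blast
qed

lemma psd_matrix_gram:
  fixes C :: "real^'k^'n"
  shows "psd_matrix (C ** transpose C)"
proof -
  have "x \<bullet> ((C ** transpose C) *v x) = (transpose C *v x) \<bullet> (transpose C *v x)" for x
    by (metis dot_lmul_matrix matrix_vector_mul_assoc transpose_matrix_vector)
  then show ?thesis
    by (simp add: psd_matrix_def symmetric_matrix_def matrix_transpose_mul)
qed

section \<open>Powers and traces\<close>

text \<open>Both sides are the alternating word X Y X ... Y X, bracketed differently.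
  \<open>X\<close> may be rectangular, so this moves between n x n and k x k powers.\<close>

lemma matpow_push_through:
  "matpow (X ** Y) k ** X = X ** matpow (Y ** X) k"
proof (induction k)
  case (Suc k)
  have "matpow (X ** Y) (Suc k) ** X = X ** Y ** (matpow (X ** Y) k ** X)"
    by (simp add: matrix_mul_assoc)
  also have "\<dots> = X ** matpow (Y ** X) (Suc k)"
    unfolding Suc.IH by (simp add: matrix_mul_assoc)
  finally show ?case .
qed simp

lemma matpow_commute: "matpow M k ** M = M ** matpow M k"
  using matpow_push_through[of M "mat 1" k] by simp

lemma transpose_matpow: "transpose (matpow M k) = matpow (transpose M) k"
  by (induction k) (simp_all add: matrix_transpose_mul matpow_commute)

text \<open>Cyclicity of the trace for rectangular factors. The exponent is positive because at
  exponent 0 the two traces are the sizes of the two products, which may differ.\<close>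

lemma trace_matpow_swap:
  "trace (matpow (X ** Y) (Suc k)) = trace (matpow (Y ** X) (Suc k))"
proof -
  have "trace (matpow (X ** Y) (Suc k)) = trace (X ** (Y ** matpow (X ** Y) k))"
    by (simp add: matrix_mul_assoc)
  also have "\<dots> = trace (Y ** (matpow (X ** Y) k ** X))"
    by (subst trace_mul_sym) (simp add: matrix_mul_assoc)
  also have "\<dots> = trace (matpow (Y ** X) (Suc k))"
    by (simp add: matpow_push_through matrix_mul_assoc)
  finally show ?thesis .
qed

lemma trace_transpose [simp]: "trace (transpose M) = trace M"
  by (simp add: trace_def transpose_def)

lemma trace_scaleR: "trace (c *\<^sub>R M :: real^'n^'n) = c * trace M"
  by (simp add: trace_def sum_distrib_left)

lemma matpow_conjugate_diagonal:
  assumes "orthogonal_matrix U"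
  shows "matpow (U ** diagonal d ** transpose U) m = U ** diagonal (\<lambda>i. d i ^ m) ** transpose U"
proof -
  have UU: "transpose U ** U = mat 1" "U ** transpose U = mat 1"
    using assms by (auto simp: orthogonal_matrix_def)
  \<comment> \<open>Appending \<open>U ** transpose U\<close> supplies the trailing factor
    \<open>U\<close> that pushing through requires.\<close>
  have "matpow (U ** diagonal d ** transpose U) m = matpow (U ** (diagonal d ** transpose U)) m ** U ** transpose U"
    by (simp add: matrix_mul_assoc[symmetric] UU)
  also have "\<dots> = U ** matpow (diagonal d ** transpose U ** U) m ** transpose U"
    by (simp add: matpow_push_through)
  also have "diagonal d ** transpose U ** U = diagonal d"
    by (simp add: matrix_mul_assoc[symmetric] UU)
  finally show ?thesis by (simp add: matpow_diagonal)
qed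

lemma trace_diagonal_sandwich:
  "trace (diagonal d ** W ** diagonal e ** transpose W) = (\<Sum>i\<in>UNIV. \<Sum>j\<in>UNIV. d i * e j * (W $ i $ j)\<^sup>2)"
proof -
  have "(diagonal d ** W ** diagonal e ** transpose W) $ i $ i = (\<Sum>j\<in>UNIV. d i * e j * (W $ i $ j)\<^sup>2)" for i
    unfolding matrix_matrix_mult_def[of "diagonal d ** W ** diagonal e"]
    by (simp add: matrix_mult_diagonal_nth diagonal_mult_matrix_nth transpose_def power2_eq_square mult_ac)
  then show ?thesis by (simp add: trace_def)
qed

section \<open>Young's inequality for traces\<close>

text \<open>Young's inequality with denominators cleared. The induction multiplies the previous case
  by \<open>b\<close> and adds the nonnegative product of \<open>a - b\<close> and
  \<open>a ^ Suc k - b ^ Suc k\<close>.\<close>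

lemma weighted_am_gm_power:
  fixes a b :: real
  assumes "a \<ge> 0" "b \<ge> 0"
  shows "(real k + 1) * (a * b ^ k) \<le> a ^ Suc k + real k * b ^ Suc k"
proof (induction k)
  case (Suc k)
  have "0 \<le> (a - b) * (a ^ Suc k - b ^ Suc k)"
  proof (cases "a \<le> b")
    case True
    then show ?thesis using assms by (intro mult_nonpos_nonpos) (auto simp del: power_Suc intro: power_mono)
  next
    case False
    then show ?thesis using assms by (intro mult_nonneg_nonneg) (auto simp del: power_Suc intro: power_mono)
  qed
  moreover have "b * ((real k + 1) * (a * b ^ k)) \<le> b * (a ^ Suc k + real k * b ^ Suc k)"
    using Suc assms by (intro mult_left_mono)
  ultimately show ?case by (simp add: algebra_simps)
qed simp

text \<open>In eigenbases of \<open>X\<close> and \<open>Y\<close> all traces become sums against the doubly stochastic weights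
  \<open>(W $ i $ j)\<^sup>2\<close> with \<open>W\<close> the orthogonal change of basis, so the inequality reduces to the scalar one
  for each pair of eigenvalues.\<close>

theorem trace_young_inequality:
  fixes X Y :: "real^'n^'n"
  assumes "psd_matrix X" "psd_matrix Y"
  shows "(real k + 1) * trace (X ** matpow Y k) \<le> trace (matpow X (Suc k)) + real k * trace (matpow Y (Suc k))"
proof -
  obtain U d where U: "orthogonal_matrix U" and X: "X = U ** diagonal d ** transpose U"
    and d: "\<And>i. d i \<ge> 0"
    using psd_matrix_diagonalization[OF assms(1)] by metis
  obtain V e where V: "orthogonal_matrix V" and Y: "Y = V ** diagonal e ** transpose V"
    and e: "\<And>i. e i \<ge> 0"
    using psd_matrix_diagonalization[OF assms(2)] by metis
  define W where "W = transpose U ** V"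
  \<comment> \<open>One formula covers all three traces: exponents \<open>(1, k)\<close>,
    \<open>(Suc k, 0)\<close> and \<open>(0, Suc k)\<close>. A zero exponent encodes that the
    weights sum to 1 along rows or columns.\<close>
  have mixed: "trace (matpow X a ** matpow Y b) = (\<Sum>i\<in>UNIV. \<Sum>j\<in>UNIV. d i ^ a * e j ^ b * (W $ i $ j)\<^sup>2)"
    for a b
  proof -
    have "trace (matpow X a ** matpow Y b)
        = trace (U ** (diagonal (\<lambda>i. d i ^ a) ** transpose U ** V ** diagonal (\<lambda>j. e j ^ b) ** transpose V))"
      by (simp add: X Y matpow_conjugate_diagonal U V matrix_mul_assoc)
    also have "\<dots> = trace (diagonal (\<lambda>i. d i ^ a) ** W ** diagonal (\<lambda>j. e j ^ b) ** transpose W)"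
      by (subst trace_mul_sym) (simp add: W_def matrix_transpose_mul matrix_mul_assoc)
    finally show ?thesis by (simp add: trace_diagonal_sandwich)
  qed
  have "(real k + 1) * trace (X ** matpow Y k)
      = (\<Sum>i\<in>UNIV. \<Sum>j\<in>UNIV. (real k + 1) * (d i * e j ^ k) * (W $ i $ j)\<^sup>2)"
    using mixed[of 1 k] by (simp add: sum_distrib_left mult_ac)
  also have "\<dots> \<le> (\<Sum>i\<in>UNIV. \<Sum>j\<in>UNIV. (d i ^ Suc k + real k * e j ^ Suc k) * (W $ i $ j)\<^sup>2)"
    using weighted_am_gm_power[OF d e] by (intro sum_mono mult_right_mono) auto
  also have "\<dots> = trace (matpow X (Suc k)) + real k * trace (matpow Y (Suc k))"
    using mixed[of "Suc k" 0] mixed[of 0 "Suc k"]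
    by (simp add: sum_distrib_left sum.distrib algebra_simps)
  finally show ?thesis .
qed

text \<open>Transfers the inequality for positive semidefinite n x n matrices to the k x k matrices
  inside \<open>f\<close>, through a symmetric square root of \<open>A\<close>.\<close>

lemma trace_young_inequality_congruence:
  fixes A :: "real^'n^'n" and P P' :: "real^'k^'n"
  assumes "psd_matrix A"
  shows "(real k + 1) * trace (transpose P' ** (A ** matpow (P ** transpose P ** A) k) ** P')
    \<le> trace (matpow (transpose P' ** A ** P') (Suc k)) + real k * trace (matpow (transpose P ** A ** P) (Suc k))"
proof -
  obtain B where B: "transpose B = B" "A = B ** B"
    using psd_matrix_sqrt[OF assms] by metis
  define gram where "gram = (\<lambda>R::real^'k^'n. (B ** R) ** transpose (B ** R))"
  have psd: "psd_matrix (gram R)" for R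
    by (simp add: gram_def psd_matrix_gram)
  \<comment> \<open>\<open>gram R\<close> and \<open>transpose R ** A ** R\<close> multiply
    \<open>B ** R\<close> and its transpose in opposite orders.\<close>
  have power: "trace (matpow (gram R) (Suc k)) = trace (matpow (transpose R ** A ** R) (Suc k))" for R
    unfolding gram_def
    by (subst trace_matpow_swap) (simp add: B matrix_transpose_mul matrix_mul_assoc)
  \<comment> \<open>Splitting every \<open>A\<close> as \<open>B ** B\<close> and regrouping the
    word gives \<open>B ** matpow (gram P) k ** B\<close>; the outer factors then join
    \<open>P'\<close> to form \<open>gram P'\<close>.\<close>
  have "A ** matpow (P ** transpose P ** A) k = B ** (B ** matpow ((P ** transpose P ** B) ** B) k)"
    by (simp add: B(2) matrix_mul_assoc)
  also have "\<dots> = B ** (matpow (gram P) k ** B)"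
    unfolding matpow_push_through[symmetric]
    by (simp add: gram_def B(1) matrix_transpose_mul matrix_mul_assoc)
  finally have "trace (transpose P' ** (A ** matpow (P ** transpose P ** A) k) ** P')
      = trace ((transpose P' ** B ** matpow (gram P) k) ** (B ** P'))"
    by (simp add: matrix_mul_assoc)
  also have "\<dots> = trace (gram P' ** matpow (gram P) k)"
    by (subst trace_mul_sym) (simp add: gram_def B(1) matrix_transpose_mul matrix_mul_assoc)
  finally show ?thesis
    using trace_young_inequality[OF psd psd, of k P' P] by (simp only: power)
qed

section \<open>The derivative of the trace of a power\<close>

lemma matrix_add_rdistrib: "((B + C) ** A) = (B ** A) + (C ** A)"
  by (vector matrix_matrix_mult_def sum.distrib[symmetric] field_simps)

lemma bounded_bilinear_matrix_mult:
  "bounded_bilinear ((**) :: real^'k^'n \<Rightarrow> real^'l^'k \<Rightarrow> real^'l^'n)"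
  by (auto simp: bilinear_conv_bounded_bilinear[symmetric] bilinear_def matrix_add_ldistrib
      matrix_add_rdistrib matrix_scalar_ac scalar_matrix_assoc intro!: linearI)

lemmas has_vector_derivative_matrix_mult =
  bounded_bilinear.has_vector_derivative[OF bounded_bilinear_matrix_mult]

lemma bounded_linear_trace: "bounded_linear (trace :: real^'n^'n \<Rightarrow> real)"
  by (auto simp: linear_conv_bounded_linear[symmetric] trace_add trace_scaleR intro!: linearI)

text \<open>The product rule leaves \<open>G'\<close> in the middle of a word in \<open>G t\<close>; testing against every \<open>C\<close>
  commuting with \<open>G t\<close> lets the trace move it to the end, and makes the induction go through.\<close>

lemma matpow_has_vector_derivative:
  fixes G :: "real \<Rightarrow> real^'n^'n"
  assumes G: "(G has_vector_derivative G') (at t)"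
  shows "\<exists>D. ((\<lambda>s. matpow (G s) m) has_vector_derivative D) (at t) \<and>
    (\<forall>C. C ** G t = G t ** C \<longrightarrow> trace (C ** D) = real m * trace (C ** matpow (G t) (m - 1) ** G'))"
proof (induction m)
  case 0
  then show ?case by (intro exI[of _ 0]) (auto simp: trace_def)
next
  case (Suc m)
  then obtain D where D: "((\<lambda>s. matpow (G s) m) has_vector_derivative D) (at t)"
    and tr: "\<And>C. C ** G t = G t ** C \<Longrightarrow> trace (C ** D) = real m * trace (C ** matpow (G t) (m - 1) ** G')"
    by blast
  have "trace (C ** (G t ** D + G' ** matpow (G t) m)) = real (Suc m) * trace (C ** matpow (G t) m ** G')"
    if C: "C ** G t = G t ** C" for C
  proof -
    \<comment> \<open>The induction hypothesis is applied to \<open>C ** G t\<close>, which commutes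
      with \<open>G t\<close> as well.\<close>
    have "(C ** G t) ** G t = G t ** (C ** G t)" using C by (metis matrix_mul_assoc)
    then have "trace (C ** G t ** D) = real m * trace (C ** G t ** matpow (G t) (m - 1) ** G')"
      by (rule tr)
    \<comment> \<open>For \<open>m = 0\<close> the exponent \<open>m - 1\<close> is truncated to 0,
      but the factor \<open>real m\<close> makes both sides vanish.\<close>
    also have "\<dots> = real m * trace (C ** matpow (G t) m ** G')"
      by (cases m) (simp_all add: matrix_mul_assoc)
    finally have 1: "trace (C ** (G t ** D)) = real m * trace (C ** matpow (G t) m ** G')"
      by (simp add: matrix_mul_assoc)
    have "C ** matpow (G t) m = matpow (G t) m ** C"
    proof (induction m)
      case (Suc m)
      then show ?case by (metis C matpow.simps(2) matrix_mul_assoc)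
    qed simp
    moreover have "trace (C ** (G' ** matpow (G t) m)) = trace (matpow (G t) m ** C ** G')"
      by (subst matrix_mul_assoc, subst trace_mul_sym) (simp add: matrix_mul_assoc)
    ultimately show ?thesis using 1
      by (simp add: matrix_add_ldistrib trace_add algebra_simps)
  qed
  then show ?case
    using has_vector_derivative_matrix_mult[OF G D]
    by (intro exI[of _ "G t ** D + G' ** matpow (G t) m"]) simp
qed

text \<open>The preceding lemma with \<open>C = mat 1\<close>, which commutes with
  everything.\<close>

lemma trace_matpow_has_real_derivative:
  fixes G :: "real \<Rightarrow> real^'n^'n"
  assumes "(G has_vector_derivative G') (at t)"
  shows "((\<lambda>s. trace (matpow (G s) m)) has_real_derivative real m * trace (matpow (G t) (m - 1) ** G')) (at t)"
proof -
  obtain D where D: "((\<lambda>s. matpow (G s) m) has_vector_derivative D) (at t)"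
    and "mat 1 ** G t = G t ** mat 1 \<longrightarrow>
      trace (mat 1 ** D) = real m * trace (mat 1 ** matpow (G t) (m - 1) ** G')"
    using matpow_has_vector_derivative[OF assms, of m] by blast
  then show ?thesis
    using bounded_linear.has_vector_derivative[OF bounded_linear_trace D]
    by (simp add: has_real_derivative_iff_has_vector_derivative)
qed

text \<open>Reads a matrix entry off a directional derivative in trace form; the indices come out
  swapped.\<close>

lemma trace_mult_axis: "trace (M ** axis i (axis j 1)) = M $ j $ i"
  for M :: "real^'n^'k"
proof -
  have "axis i (axis j (1::real)) $ l $ p = (if l = i then if p = j then 1 else 0 else 0)" for l p
    by (simp add: axis_def)
  then show ?thesis
    by (simp add: trace_def matrix_matrix_mult_def mult_delta_right)
qed

lemma line_has_vector_derivative: "((\<lambda>t. x + t *\<^sub>R v) has_vector_derivative v) (at t)"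
  unfolding has_vector_derivative_def
  by (rule derivative_eq_intros refl)+ simp

text \<open>Along the unit matrix \<open>E\<close>, the derivative is \<open>m\<close> times a trace
  with two terms. Symmetry of \<open>A\<close> and \<open>N\<close> makes them equal, so the
  gradient is \<open>2 * m\<close> times \<open>A ** P ** N\<close>, and pushing \<open>P\<close>
  through the power \<open>N\<close> gives the stated form.\<close>

lemma has_partials_trace_matpow:
  fixes A :: "real^'n^'n" and P :: "real^'k^'n"
  assumes A: "transpose A = A"
  shows "has_partials (\<lambda>P. trace (matpow (transpose P ** A ** P) m))
    ((2 * real m) *\<^sub>R (A ** matpow (P ** transpose P ** A) (m - 1)) ** P) P"
  unfolding has_partials_def
proof (intro allI)
  fix i :: 'n and j :: 'k
  define E :: "real^'k^'n" where "E = axis i (axis j 1)"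
  define N where "N = matpow (transpose P ** A ** P) (m - 1)"
  have N: "transpose N = N"
    by (simp add: N_def transpose_matpow matrix_transpose_mul A matrix_mul_assoc)
  \<comment> \<open>The left factor is affine in \<open>t\<close>, so the product rule is needed
    only once, for its product with \<open>P + t *\<^sub>R E\<close>.\<close>
  have "((\<lambda>t. transpose (P + t *\<^sub>R E) ** A) has_vector_derivative transpose E ** A) (at 0)"
  proof -
    have "(\<lambda>t. transpose (P + t *\<^sub>R E) ** A) = (\<lambda>t. transpose P ** A + t *\<^sub>R (transpose E ** A))"
      by (auto simp: transpose_def vec_eq_iff matrix_matrix_mult_def sum_distrib_left sum.distrib algebra_simps)
    then show ?thesis by (simp only: line_has_vector_derivative)
  qed
  then have "((\<lambda>t. (transpose (P + t *\<^sub>R E) ** A) ** (P + t *\<^sub>R E)) has_vector_derivative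
      transpose P ** A ** E + transpose E ** A ** P) (at 0)"
    using has_vector_derivative_matrix_mult[OF _ line_has_vector_derivative, of _ _ 0 P E] by fastforce
  from trace_matpow_has_real_derivative[OF this, of m]
  have "((\<lambda>t. trace (matpow (transpose (P + t *\<^sub>R E) ** A ** (P + t *\<^sub>R E)) m)) has_real_derivative
      real m * trace (N ** (transpose P ** A ** E + transpose E ** A ** P))) (at 0)"
    by (simp add: N_def)
  moreover have "trace (N ** (transpose P ** A ** E + transpose E ** A ** P)) = 2 * (A ** P ** N) $ i $ j"
  proof -
    have "trace (N ** (transpose E ** A ** P)) = trace (transpose (N ** (transpose E ** A ** P)))"
      by simp
    also have "\<dots> = trace (transpose P ** A ** E ** N)"
      by (simp add: matrix_transpose_mul A N matrix_mul_assoc)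
    also have "\<dots> = trace (N ** (transpose P ** A ** E))"
      by (rule trace_mul_sym)
    finally have "trace (N ** (transpose P ** A ** E + transpose E ** A ** P)) = 2 * trace ((N ** transpose P ** A) ** E)"
      by (simp add: matrix_add_ldistrib trace_add matrix_mul_assoc)
    also have "N ** transpose P ** A = transpose (A ** P ** N)"
      by (simp add: matrix_transpose_mul A N matrix_mul_assoc)
    finally show ?thesis by (simp add: E_def trace_mult_axis) (simp add: transpose_def)
  qed
  moreover have "A ** P ** N = A ** matpow (P ** transpose P ** A) (m - 1) ** P"
    using matpow_push_through[of P "transpose P ** A" "m - 1"]
    by (simp add: N_def matrix_mul_assoc[symmetric])
  ultimately show "((\<lambda>t. trace (matpow (transpose (P + t *\<^sub>R axis i (axis j 1)) ** A ** (P + t *\<^sub>R axis i (axis j 1))) m))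
      has_real_derivative ((2 * real m) *\<^sub>R (A ** matpow (P ** transpose P ** A) (m - 1)) ** P) $ i $ j) (at 0)"
    by (simp add: E_def scalar_matrix_assoc[symmetric] mult_ac)
qed

section \<open>Properties of the matrix function \<open>H\<close> and the atomic conditions\<close>

text \<open>The word A P P^T A ... P P^T A is a palindrome up to transposition of its letters, so
  transposing it returns the same word.\<close>

lemma symmetric_alternating_product:
  fixes A :: "real^'n^'n" and P :: "real^'k^'n"
  assumes A: "transpose A = A"
  shows "transpose (A ** matpow (P ** transpose P ** A) k) = A ** matpow (P ** transpose P ** A) k"
  using matpow_push_through[of A "P ** transpose P" k]
  by (simp add: matrix_transpose_mul transpose_matpow A matrix_mul_assoc)

lemma trace_congruence_alternating_product:
  fixes A :: "real^'n^'n" and P :: "real^'k^'n"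
  shows "trace (transpose P ** (A ** matpow (P ** transpose P ** A) k) ** P)
    = trace (matpow (transpose P ** A ** P) (Suc k))"
proof -
  have "transpose P ** (A ** matpow (P ** transpose P ** A) k) ** P
      = transpose P ** A ** (matpow (P ** (transpose P ** A)) k ** P)"
    by (simp add: matrix_mul_assoc)
  then show ?thesis
    unfolding matpow_push_through by (simp add: matrix_mul_assoc)
qed

theorem theorem7p5:
  fixes A :: "real^'n^'n" and m :: nat
    and f :: "real^'k^'n \<Rightarrow> real" and H :: "real^'k^'n \<Rightarrow> real^'n^'n"
  assumes "CARD('k) \<le> CARD('n)"
    and "symmetric_matrix A"
    and "m \<ge> 1"
    and f_def: "\<And>P. f P = trace (matpow (transpose P ** A ** P) m)"
    and H_def: "\<And>P. H P = (2 * real m) *\<^sub>R (A ** matpow (P ** transpose P ** A) (m - 1))"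
  shows "(\<forall>P. symmetric_matrix (H P) \<and> has_partials f (H P ** P) P) \<and>
    (\<forall>P. trace (transpose P ** H P ** P) = 2 * real m * f P \<and>
         2 * real m * f P = 2 * real m * trace (matpow (transpose P ** A ** P) m)) \<and>
    (m = 1 \<longrightarrow> (\<forall>P P' :: real^'k^'n.
         trace (transpose P' ** H P ** P') = 2 * trace (transpose P' ** A ** P'))) \<and>
    (m > 1 \<and> psd_matrix A \<longrightarrow> (\<forall>P P' :: real^'k^'n.
         trace (transpose P' ** H P ** P')
           \<le> 2 * trace (matpow (transpose P' ** A ** P') m)
             + 2 * (real m - 1) * trace (matpow (transpose P ** A ** P) m))) \<and>
    (m = 1 \<or> m > 1 \<and> psd_matrix A \<longrightarrow>
         atomic_cond1 f H stiefel 2 (2 * (real m - 1)) \<and>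
         atomic_cond2 f H stiefel 2 (2 * (real m - 1)) \<and>
         (\<forall>\<delta>>0. atomic_function_NEPv (stiefel_nbhd \<delta>) f))"
proof -
  have A: "transpose A = A" using assms(2) by (simp add: symmetric_matrix_def)
  \<comment> \<open>Young's trace inequality is stated with exponents \<open>k\<close> and
    \<open>Suc k\<close>, so \<open>m\<close> is written as a successor.\<close>
  define k where "k = m - 1"
  have m: "m = Suc k" using assms(3) by (simp add: k_def)
  have trH: "trace (transpose R ** H P ** R)
      = 2 * real m * trace (transpose R ** (A ** matpow (P ** transpose P ** A) k) ** R)" for P R :: "real^'k^'n"
    by (simp add: H_def k_def matrix_scalar_ac scalar_matrix_assoc[symmetric] trace_scaleR)
  have symH: "symmetric_matrix (H P)" for P
    by (simp add: H_def symmetric_matrix_def transpose_scalar symmetric_alternating_product[OF A])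
  have partials: "has_partials f (H P ** P) P" for P
    using has_partials_trace_matpow[OF A, of m P] by (simp add: H_def f_def[abs_def])
  have a: "trace (transpose P ** H P ** P) = 2 * real m * f P" for P
    by (simp add: trH f_def trace_congruence_alternating_product m del: matpow.simps)
  have b1: "trace (transpose P' ** H P ** P') = 2 * trace (transpose P' ** A ** P')" if "m = 1" for P P' :: "real^'k^'n"
    using that by (simp add: trH k_def)
  have b2: "trace (transpose P' ** H P ** P')
      \<le> 2 * trace (matpow (transpose P' ** A ** P') m) + 2 * (real m - 1) * trace (matpow (transpose P ** A ** P) m)"
    if "psd_matrix A" for P P' :: "real^'k^'n"
    using trace_young_inequality_congruence[OF that, of k P' P]
    by (simp add: trH m algebra_simps del: matpow.simps)
  \<comment> \<open>The constants add up to \<open>2 + 2 * (m - 1) = 2 * m\<close>, the factor in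
    the trace identity.\<close>
  have c1: "atomic_cond1 f H stiefel 2 (2 * (real m - 1))"
    by (simp add: atomic_cond1_def a)
  have c2: "atomic_cond2 f H stiefel 2 (2 * (real m - 1))" if "m = 1 \<or> m > 1 \<and> psd_matrix A"
    unfolding atomic_cond2_def
  proof (intro ballI exI[of _ "mat 1"] conjI)
    fix P P' :: "real^'k^'n" assume "P' \<in> stiefel"
    then show "P' ** mat 1 \<in> stiefel" by simp
    show "trace (transpose P' ** H P ** P') \<le> 2 * f (P' ** mat 1) + 2 * (real m - 1) * f P"
      using that b1[of P' P] b2[of P' P] by (auto simp: f_def)
  qed (simp add: stiefel_def)
  have "atomic_function_NEPv (stiefel_nbhd \<delta>) f" if "m = 1 \<or> m > 1 \<and> psd_matrix A" "\<delta> > 0" for \<delta>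
    unfolding atomic_function_NEPv_def
    using c1 c2[OF that(1)] symH that(2) assms(3)
    by (intro conjI exI[of _ \<delta>] exI[of _ H] exI[of _ stiefel] exI[of _ 2] exI[of _ "2 * (real m - 1)"]) auto
  with symH partials a b1 b2 c1 c2 f_def show ?thesis by simp
qed

end
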